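(* Let $q$ be a positive integer and let $S\in\mathbb C(u)$ be a nonconstant rational function of degree $n$. Then $$T\bigl(r,S(e^{z/q})\bigr)=\frac{n}{\pi q}\,r+O(1)\qquad(r\to\infty).$$
   Context: $T(r,f)=m(r,f)+N(r,f)$ is the Nevanlinna characteristic of a meromorphic function $f$ on $\mathbb C$, where $m(r,f)=\frac1{2\pi}\int_0^{2\pi}\log^+|f(re^{i\theta})|\,d\theta$ and $N(r,f)$ is the integrated counting function of poles with multiplicity, with the usual convention at the origin: $N(r,f)=\int_0^r\frac{n(s,f)-n(0,f)}{s}\,ds+n(0,f)\log r$, where $n(s,f)$ is the number of poles in $|z|\le s$ counted with multiplicity. The degree of a rational function $P/Q$ in lowest terms is $\max(\deg P,\deg Q)$. *)

theory Defs
  imports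
    "HOL-Complex_Analysis.Complex_Analysis"
    "HOL-Computational_Algebra.Computational_Algebra"
    "HOL-Computational_Algebra.Field_as_Ring"
    "HOL-Library.Landau_Symbols"
begin

section \<open>Rational functions of one complex variable\<close>

text \<open>
  The field of rational functions is the fraction field of the polynomial ring. The function
  \<^const>\<open>quot_of_fract\<close> returns the numerator and denominator in lowest terms, the denominator
  being normalised (monic).
\<close>

type_synonym ratfun = "complex poly fract"

definition ratfun_num :: "ratfun \<Rightarrow> complex poly" where
  "ratfun_num S = fst (quot_of_fract S)"

definition ratfun_denom :: "ratfun \<Rightarrow> complex poly" where
  "ratfun_denom S = snd (quot_of_fract S)"

definition ratfun_degree :: "ratfun \<Rightarrow> nat" where
  "ratfun_degree S = max (degree (ratfun_num S)) (degree (ratfun_denom S))"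

definition ratfun_const :: "complex \<Rightarrow> ratfun" where
  "ratfun_const c = Fract [:c:] 1"

text \<open>
  At a pole of \<open>S\<close> the value is \<open>0\<close>, because \<open>x / 0 = 0\<close>; this is the convention of
  \<^const>\<open>nicely_meromorphic_on\<close>. Elsewhere it is the value of the rational function,
  as numerator and denominator have no common root.
\<close>

definition ratfun_eval :: "ratfun \<Rightarrow> complex \<Rightarrow> complex" where
  "ratfun_eval S u = poly (ratfun_num S) u / poly (ratfun_denom S) u"


section \<open>The Nevanlinna characteristic\<close>

text \<open>The value at \<open>0\<close> is \<open>0\<close>, as it should be, since \<open>ln 0 = 0\<close> in the library.\<close>

definition log_plus :: "real \<Rightarrow> real" where
  "log_plus x = max 0 (ln x)"

text \<open>
  The definitions below are meant for functions that are meromorphic on the whole plane. For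
  these the integrals exist and the set of poles in a closed disc is finite. The values of the
  function at its poles do not matter, as there are only finitely many on each circle.
\<close>

definition proximity :: "real \<Rightarrow> (complex \<Rightarrow> complex) \<Rightarrow> real" where
  "proximity r f =
     1 / (2 * pi) * integral {0..2 * pi} (\<lambda>\<theta>. log_plus (norm (f (of_real r * cis \<theta>))))"

text \<open>The multiplicity of a pole \<open>z\<close> is \<open>- zorder f z\<close>.\<close>

definition pole_count :: "real \<Rightarrow> (complex \<Rightarrow> complex) \<Rightarrow> nat" where
  "pole_count s f = (\<Sum>z | norm z \<le> s \<and> is_pole f z. nat (- zorder f z))"

definition int_pole_count :: "real \<Rightarrow> (complex \<Rightarrow> complex) \<Rightarrow> real" where
  "int_pole_count r f =
     integral {0..r} (\<lambda>s. (real (pole_count s f) - real (pole_count 0 f)) / s)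
       + real (pole_count 0 f) * ln r"

definition nevanlinna_char :: "real \<Rightarrow> (complex \<Rightarrow> complex) \<Rightarrow> real" where
  "nevanlinna_char r f = proximity r f + int_pole_count r f"

end

theory Submission
  imports Defs
begin

text \<open>
  Write \<open>S = P / Q\<close> in lowest terms and \<open>g z = Q (exp (z / q))\<close>. The poles of \<open>S (exp (z / q))\<close> are
  the zeros of \<open>g\<close>, so Jensen's formula expresses \<open>N\<close> as the circle mean of \<open>ln \<bar>g\<bar>\<close> up to a
  constant. Since \<open>log\<^sup>+ \<bar>P / Q\<bar> + ln \<bar>Q\<bar> = ln (max \<bar>P\<bar> \<bar>Q\<bar>)\<close>, the characteristic is the circle
  mean of \<open>ln (max \<bar>P u\<bar> \<bar>Q u\<bar>)\<close> at \<open>u = exp (z / q)\<close>, up to a constant. By coprimality this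
  differs boundedly from \<open>n * log\<^sup>+ \<bar>u\<bar> = n * max 0 (Re z) / q\<close>, whose mean on the circle of radius
  \<open>r\<close> is \<open>n * r / (pi * q)\<close>.
\<close>

section \<open>Circle means of the logarithm of the modulus\<close>

text \<open>A zero-free \<open>h\<close> on a disc has a holomorphic logarithm \<open>H\<close>, and
  \<open>ln (norm (h z))\<close> is the harmonic function \<open>Re (H z)\<close>. Its mean value
  property is Cauchy's formula for \<open>H\<close> at the centre.\<close>

lemma circle_mean_ln_nonzero:
  assumes h: "h holomorphic_on ball 0 R" "\<And>z. z \<in> ball 0 R \<Longrightarrow> h z \<noteq> 0" and r: "0 < r" "r < R"
  shows "((\<lambda>\<theta>. ln (norm (h (of_real r * cis \<theta>)))) has_integral 2 * pi * ln (norm (h 0))) {0..2 * pi}"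
proof -
  obtain H where H: "H holomorphic_on ball 0 R" "\<And>x. x \<in> ball 0 R \<Longrightarrow> exp (H x) = h x"
    using holomorphic_logarithm_exists[of "ball 0 R" h 0] h r by auto
  have ln_h: "ln (norm (h z)) = Re (H z)" if "z \<in> ball 0 R" for z
    by (metis H(2) ln_exp norm_exp_eq_Re that)
  have "((\<lambda>u. H u / (u - 0)) has_contour_integral 2 * of_real pi * \<i> * H 0) (circlepath 0 r)"
    by (rule Cauchy_integral_circlepath_simple)
      (use H r in \<open>auto intro: holomorphic_on_subset[where s = "ball 0 R"]\<close>)
  hence "((\<lambda>t. H (0 + of_real r * cis t) / (0 + of_real r * cis t - 0) * of_real r * \<i> * cis t)
           has_integral 2 * of_real pi * \<i> * H 0) {0..2 * pi}"
    unfolding circlepath_def by (subst (asm) has_contour_integral_part_circlepath_iff) auto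
  \<comment> \<open>On the circle dz / z is i times dt, so the quotient disappears; the imaginary
    part of \<open>\<i> * H\<close> is then the real part of \<open>H\<close>.\<close>
  hence "((\<lambda>t. \<i> * H (of_real r * cis t)) has_integral 2 * of_real pi * \<i> * H 0) {0..2 * pi}"
    using r by (elim has_integral_eq[rotated]) (auto simp: field_simps)
  from has_integral_linear[OF this bounded_linear_Im]
  have "((\<lambda>t. Re (H (of_real r * cis t))) has_integral 2 * pi * Re (H 0)) {0..2 * pi}"
    by (simp add: o_def)
  moreover have "ln (norm (h 0)) = Re (H 0)" using ln_h r by simp
  ultimately show ?thesis
    using r by (auto intro!: has_integral_eq[rotated] simp: ln_h norm_mult)
qed

text \<open>Reflection in the unit circle keeps the modulus there: \<open>cis \<theta> - c\<close>
  may be replaced by \<open>1 - cnj c * cis \<theta>\<close>, whose zero lies outside the closed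
  disc and whose value at the centre is 1.\<close>

lemma circle_mean_ln_linear_unit:
  assumes "norm c < 1"
  shows "((\<lambda>\<theta>. ln (norm (cis \<theta> - c))) has_integral 0) {0..2 * pi}"
proof -
  \<comment> \<open>The harmonic mean of 1 and of the modulus 1 / |c| of the reflected zero, hence
    strictly between them; in this form it also makes sense for c = 0.\<close>
  define R where "R = 2 / (1 + norm c)"
  have pos: "1 + norm c > 0"
    by (simp add: add_pos_nonneg)
  have "((\<lambda>\<theta>. ln (norm (1 - cnj c * (of_real 1 * cis \<theta>)))) has_integral 2 * pi * ln (norm (1 - cnj c * 0))) {0..2 * pi}"
  proof (rule circle_mean_ln_nonzero[where R = R])
    show "1 < R" using assms pos by (simp add: R_def field_simps)
    show "1 - cnj c * z \<noteq> 0" if "z \<in> ball 0 R" for z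
    proof
      assume "1 - cnj c * z = 0"
      hence "norm (cnj c * z) = 1" by simp
      moreover have "norm c * norm z \<le> norm c * R"
        using that by (intro mult_left_mono) auto
      moreover have "norm c * R < 1"
        using assms pos by (simp add: R_def field_simps)
      ultimately show False by (simp add: norm_mult)
    qed
  qed (auto intro!: holomorphic_intros)
  moreover have "norm (cis \<theta> - c) = norm (1 - cnj c * cis \<theta>)" for \<theta>
  proof -
    have "norm (cis \<theta> - c) = norm (cnj (cis \<theta> - c) * cis \<theta>)"
      unfolding norm_mult complex_mod_cnj by simp
    also have "cnj (cis \<theta> - c) * cis \<theta> = 1 - cnj c * cis \<theta>"
      by (simp add: algebra_simps cis_cnj cis_mult)
    finally show ?thesis .
  qed
  ultimately show ?thesis by simp
qed

text \<open>A circle meets a given point for at most one angle per period. Such angles are the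
  exceptional sets of the spike arguments below, where \<open>ln\<close> of a product or quotient
  fails to split because an argument is 0.\<close>

lemma negligible_cis_eq: "negligible {\<theta>. cis \<theta> = a}"
proof (cases "\<exists>\<alpha>. cis \<alpha> = a")
  case True
  then obtain \<alpha> where \<alpha>: "a = cis \<alpha>" by auto
  have "{\<theta>. cis \<theta> = a} \<subseteq> range (\<lambda>n::int. \<alpha> + 2 * pi * of_int n)"
  proof
    fix \<theta> assume "\<theta> \<in> {\<theta>. cis \<theta> = a}"
    hence "sin \<theta> = sin \<alpha> \<and> cos \<theta> = cos \<alpha>" by (simp add: \<alpha> complex_eq_iff)
    thus "\<theta> \<in> range (\<lambda>n::int. \<alpha> + 2 * pi * of_int n)"
      unfolding sin_cos_eq_iff by auto
  qed
  hence "countable {\<theta>. cis \<theta> = a}"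
    by (rule countable_subset) auto
  thus ?thesis by (simp add: negligible_iff_null_sets countable_imp_null_set_lborel null_sets_completionI)
qed (auto simp: not_ex)

text \<open>
  Since \<open>\<bar>cis \<theta> - s * a\<bar>\<^sup>2 / s = 1 / s + s - 2 * Re (cis \<theta> * cnj a)\<close> decreases as \<open>s\<close> increases to \<open>1\<close>,
  the logarithmic singularity on the circle is handled by monotone convergence.
\<close>
lemma circle_mean_ln_linear_on_circle:
  assumes "norm a = 1"
  shows "((\<lambda>\<theta>. ln (norm (cis \<theta> - a))) has_integral 0) {0..2 * pi}"
proof -
  define s :: "nat \<Rightarrow> real" where "s k = 1 - 1 / (real k + 2)" for k
  \<comment> \<open>This is the logarithm of the decreasing expression above at s =
    \<open>s k\<close>. The term \<open>ln (s k)\<close> is what makes the sequence monotone, and it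
    vanishes in the limit.\<close>
  define f where "f k \<theta> = 2 * ln (norm (cis \<theta> - of_real (s k) * a)) - ln (s k)" for k \<theta>
  define N where "N = {\<theta>. cis \<theta> = a}"
  have s: "0 < s k" "s k < 1" "s k \<le> s (Suc k)" for k
    by (auto simp: s_def field_simps)
  have s_lim: "s \<longlonglongrightarrow> 1"
    using tendsto_diff[OF tendsto_const LIMSEQ_Suc[OF LIMSEQ_inverse_real_of_nat], of 1]
    by (simp add: s_def[abs_def] inverse_eq_divide add.commute)
  have f_int: "(f k has_integral - (2 * pi * ln (s k))) {0..2 * pi}" for k
  proof -
    have "norm (of_real (s k) * a) < 1"
      using s[of k] assms by (simp add: norm_mult)
    note unit = circle_mean_ln_linear_unit[OF this]
    from has_integral_diff[OF has_integral_mult_right[OF unit, of 2] has_integral_const_real[of "ln (s k)" 0 "2 * pi"]]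
    show ?thesis unfolding f_def by simp
  qed
  have sq: "(norm (cis \<theta> - of_real t * a))\<^sup>2 = 1 + t\<^sup>2 - 2 * t * Re (cis \<theta> * cnj a)" for t \<theta>
  proof -
    have "(norm (cis \<theta> - of_real t * a))\<^sup>2 = (norm (cis \<theta>))\<^sup>2 + t\<^sup>2 * (norm a)\<^sup>2 - 2 * t * Re (cis \<theta> * cnj a)"
      unfolding cmod_power2 by (simp add: power2_eq_square algebra_simps)
    thus ?thesis using assms by simp
  qed
  have f_eq: "f k \<theta> = ln (1 / s k + s k - 2 * Re (cis \<theta> * cnj a))"
     and pos: "0 < 1 / s k + s k - 2 * Re (cis \<theta> * cnj a)" for k \<theta>
  proof -
    have nz: "cis \<theta> - of_real (s k) * a \<noteq> 0"
    proof
      assume "cis \<theta> - of_real (s k) * a = 0"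
      hence "norm (cis \<theta>) = norm (of_real (s k) * a)" by simp
      thus False using s[of k] assms by (simp add: norm_mult)
    qed
    have eq: "(norm (cis \<theta> - of_real (s k) * a))\<^sup>2 / s k = 1 / s k + s k - 2 * Re (cis \<theta> * cnj a)"
      using s(1)[of k] unfolding sq by (simp add: add_divide_distrib diff_divide_distrib power2_eq_square)
    have "f k \<theta> = ln ((norm (cis \<theta> - of_real (s k) * a))\<^sup>2 / s k)"
      using nz s[of k] by (simp add: f_def ln_div ln_realpow)
    thus "f k \<theta> = ln (1 / s k + s k - 2 * Re (cis \<theta> * cnj a))"
      unfolding eq .
    show "0 < 1 / s k + s k - 2 * Re (cis \<theta> * cnj a)"
      unfolding eq[symmetric] using nz s[of k] by simp
  qed
  have anti: "f (Suc k) \<theta> \<le> f k \<theta>" for k \<theta>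
  proof -
    have "1 / y + y \<le> 1 / x + x" if "0 < x" "x \<le> y" "y < 1" for x y :: real
    proof -
      have nz: "x \<noteq> 0" "y \<noteq> 0" using that by auto
      have "x * y \<le> 1" using that by (intro mult_le_one) auto
      moreover have "0 < x * y" using that by simp
      ultimately have "(y - x) * 1 \<le> (y - x) * (1 / (x * y))"
        using that(2) by (intro mult_left_mono) (auto simp: le_divide_eq_1)
      also have "\<dots> = 1 / x - 1 / y"
        using nz by (simp add: diff_divide_distrib)
      finally show ?thesis by simp
    qed
    hence "1 / s (Suc k) + s (Suc k) \<le> 1 / s k + s k" using s by blast
    thus ?thesis unfolding f_eq using pos by (subst ln_le_cancel_iff) auto
  qed
  \<comment> \<open>On \<open>N\<close> the values \<open>f k \<theta>\<close> tend to minus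
    infinity, whereas \<open>ln 0 = 0\<close>. Resetting both to 0 there gives convergence at every
    angle.\<close>
  define g where "g \<theta> = (if \<theta> \<in> N then 0 else 2 * ln (norm (cis \<theta> - a)))" for \<theta>
  define f' where "f' k \<theta> = (if \<theta> \<in> N then 0 else f k \<theta>)" for k \<theta>
  have N: "negligible N" unfolding N_def by (rule negligible_cis_eq)
  have f'_int: "(f' k has_integral - (2 * pi * ln (s k))) {0..2 * pi}" for k
    by (rule has_integral_spike[OF N _ f_int[of k]]) (auto simp: f'_def)
  have int_lim: "(\<lambda>k. - (2 * pi * ln (s k))) \<longlonglongrightarrow> 0"
    using s_lim by (auto intro!: tendsto_eq_intros)
  have "g integrable_on {0..2 * pi} \<and> (\<lambda>k. integral {0..2 * pi} (f' k)) \<longlonglongrightarrow> integral {0..2 * pi} g"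
  proof (rule monotone_convergence_decreasing)
    show "f' k integrable_on {0..2 * pi}" for k using f'_int by blast
    show "f' (Suc k) \<theta> \<le> f' k \<theta>" for k \<theta> using anti by (simp add: f'_def)
    show "(\<lambda>k. f' k \<theta>) \<longlonglongrightarrow> g \<theta>" for \<theta>
    proof (cases "\<theta> \<in> N")
      case False
      hence "(\<lambda>k. f k \<theta>) \<longlonglongrightarrow> 2 * ln (norm (cis \<theta> - of_real 1 * a)) - ln 1"
        unfolding f_def by (intro tendsto_intros s_lim) (auto simp: N_def)
      thus ?thesis using False by (simp add: f'_def g_def)
    qed (auto simp: f'_def g_def)
    show "bounded (range (\<lambda>k. integral {0..2 * pi} (f' k)))"
      using convergent_imp_bounded[OF int_lim] by (simp only: f'_int[THEN integral_unique])
  qed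
  hence "(g has_integral 0) {0..2 * pi}"
    using int_lim LIMSEQ_unique unfolding f'_int[THEN integral_unique] has_integral_iff by blast
  hence half: "((\<lambda>\<theta>. 1 / 2 * g \<theta>) has_integral 1 / 2 * 0) {0..2 * pi}"
    by (rule has_integral_mult_right)
  have "((\<lambda>\<theta>. ln (norm (cis \<theta> - a))) has_integral 1 / 2 * 0) {0..2 * pi}"
    by (rule has_integral_spike[OF N _ half]) (simp add: g_def)
  thus ?thesis by simp
qed

text \<open>If \<open>norm a \<le> r\<close>, scaling by r reduces to the unit circle, with mean 0.
  Otherwise z - a has no zero in the ball of radius \<open>norm a\<close>, which contains the
  circle, so the value at the centre is the mean.\<close>

lemma circle_mean_ln_linear:
  assumes r: "0 < r"
  shows "((\<lambda>\<theta>. ln (norm (of_real r * cis \<theta> - a))) has_integral 2 * pi * ln (max r (norm a))) {0..2 * pi}"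
proof (cases "norm a \<le> r")
  case True
  define c where "c = a / of_real r"
  have c: "norm c \<le> 1" using True r by (simp add: c_def norm_divide)
  have unit: "((\<lambda>\<theta>. ln (norm (cis \<theta> - c))) has_integral 0) {0..2 * pi}"
    using c circle_mean_ln_linear_unit[of c] circle_mean_ln_linear_on_circle[of c] by linarith
  have "((\<lambda>\<theta>. ln r + ln (norm (cis \<theta> - c))) has_integral (2 * pi * ln r + 0)) {0..2 * pi}"
    using has_integral_add[OF has_integral_const_real[of "ln r" 0 "2 * pi"] unit] by simp
  \<comment> \<open>At an angle with \<open>cis \<theta> = c\<close> the convention
    \<open>ln 0 = 0\<close> makes the left integrand 0 and the right one \<open>ln r\<close>, so
    that set is excluded.\<close>
  hence "((\<lambda>\<theta>. ln (norm (of_real r * cis \<theta> - a))) has_integral (2 * pi * ln r + 0)) {0..2 * pi}"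
  proof (rule has_integral_spike[OF negligible_cis_eq[of c], rotated])
    fix \<theta> assume "\<theta> \<in> {0..2 * pi} - {\<theta>. cis \<theta> = c}"
    moreover have "of_real r * cis \<theta> - a = of_real r * (cis \<theta> - c)"
      using r by (simp add: c_def field_simps)
    ultimately show "ln (norm (of_real r * cis \<theta> - a)) = ln r + ln (norm (cis \<theta> - c))"
      using r by (simp add: norm_mult ln_mult)
  qed
  thus ?thesis using True by (simp add: max_def)
next
  case False
  have "((\<lambda>\<theta>. ln (norm (of_real r * cis \<theta> - a))) has_integral 2 * pi * ln (norm (0 - a))) {0..2 * pi}"
    by (rule circle_mean_ln_nonzero[where R = "norm a"])
      (use False r in \<open>auto intro!: holomorphic_intros\<close>)
  thus ?thesis using False by (simp add: max_def)
qed

section \<open>Zeros of entire functions, counting of poles and Jensen's formula\<close>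

lemma zorder_prod_linear:
  fixes m :: "complex \<Rightarrow> nat"
  assumes "finite Z"
  shows "zorder (\<lambda>w. \<Prod>a\<in>Z. (w - a) ^ m a) z = (if z \<in> Z then int (m z) else 0)"
proof (rule zorder_eqI[of UNIV z "\<lambda>w. \<Prod>a\<in>Z - {z}. (w - a) ^ m a"])
  show "(\<Prod>a\<in>Z. (w - a) ^ m a) =
      (\<Prod>a\<in>Z - {z}. (w - a) ^ m a) * (w - z) powi (if z \<in> Z then int (m z) else 0)" for w
    using assms by (auto simp: prod.remove[of Z z] mult.commute)
qed (use assms in \<open>auto intro!: holomorphic_intros\<close>)

locale nonzero_entire =
  fixes g :: "complex \<Rightarrow> complex"
  assumes holo: "g holomorphic_on UNIV" and nonzero: "\<exists>w. g w \<noteq> 0"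
begin

lemma finite_zeros: "finite {z. norm z \<le> R \<and> g z = 0}"
proof (cases "g constant_on UNIV")
  case True
  hence "{z. norm z \<le> R \<and> g z = 0} = {}"
    using nonzero by (auto simp: constant_on_def)
  thus ?thesis by (metis finite.emptyI)
next
  case False
  have "finite {z \<in> cball 0 R. g z = 0}"
    by (rule holomorphic_compact_finite_zeros[OF holo]) (use False in auto)
  thus ?thesis by simp
qed

lemma eventually_nonzero: "eventually (\<lambda>w. g w \<noteq> 0) (at z)"
proof -
  obtain w where "g w \<noteq> 0" using nonzero by blast
  hence "eventually (\<lambda>w. g w \<noteq> 0 \<and> w \<in> UNIV) (at z)"
    by (intro non_zero_neighbour_alt[OF holo]) auto
  thus ?thesis by simp
qed

lemma zorder_zero: "g z = 0 \<Longrightarrow> zorder g z > 0" and zorder_nonzero: "g z \<noteq> 0 \<Longrightarrow> zorder g z = 0"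
  using zorder_exist_zero[OF holo, of z] nonzero by auto

text \<open>The product has the same zeros with the same orders as \<open>g\<close> in the open
  ball, so dividing it out leaves a zero-free holomorphic function. Zeros of \<open>g\<close> on the
  boundary circle also enter the product, but they do not vanish inside.\<close>

lemma factor_zeros_disc:
  obtains h where "h holomorphic_on ball 0 R" "\<And>z. z \<in> ball 0 R \<Longrightarrow> h z \<noteq> 0"
    "\<And>z. z \<in> ball 0 R \<Longrightarrow> g z = h z * (\<Prod>a | norm a \<le> R \<and> g a = 0. (z - a) ^ nat (zorder g a))"
proof -
  define Z where "Z = {a. norm a \<le> R \<and> g a = 0}"
  define p where "p z = (\<Prod>a\<in>Z. (z - a) ^ nat (zorder g a))" for z
  have fin: "finite Z" unfolding Z_def by (rule finite_zeros)
  obtain h where "h holomorphic_on ball 0 R" "\<And>z. z \<in> ball 0 R \<Longrightarrow> h z \<noteq> 0"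
      "\<And>z. z \<in> ball 0 R \<Longrightarrow> g z = h z * p z"
  proof (rule holomorphic_zorder_factorization)
    show "g holomorphic_on ball 0 R" using holo by (rule holomorphic_on_subset) auto
    show "p holomorphic_on ball 0 R" unfolding p_def by (auto intro!: holomorphic_intros)
    show "p z = 0 \<longleftrightarrow> g z = 0" if "z \<in> ball 0 R" for z
      using that fin zorder_zero by (auto simp: p_def Z_def)
    show "zorder p z = zorder g z" if "z \<in> ball 0 R" for z
      unfolding p_def using that zorder_prod_linear[OF fin, of "\<lambda>a. nat (zorder g a)" z]
        zorder_zero[of z] zorder_nonzero[of z] by (auto simp: Z_def)
  qed auto
  thus ?thesis using that unfolding p_def Z_def by blast
qed

text \<open>No zero of \<open>g\<close> is cancelled by \<open>p\<close>, so the poles and their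
  multiplicities depend on \<open>g\<close> alone. This lets 1 / g stand in for p / g in the
  counting function.\<close>

lemma pole_count_divide:
  assumes p: "p holomorphic_on UNIV" and coprime: "\<And>z. g z = 0 \<Longrightarrow> p z \<noteq> 0"
  shows "pole_count s (\<lambda>z. p z / g z) = (\<Sum>z | norm z \<le> s \<and> g z = 0. nat (zorder g z))"
proof -
  have analytic: "p analytic_on {z}" "g analytic_on {z}" for z
    using p holo by (auto simp: analytic_at)
  have pole: "is_pole (\<lambda>z. p z / g z) z \<longleftrightarrow> g z = 0" for z
  proof
    assume "g z = 0"
    show "is_pole (\<lambda>z. p z / g z) z"
    proof (rule is_pole_divide)
      show "isCont p z" using analytic(1) by (rule analytic_at_imp_isCont)
      have "g \<midarrow>z\<rightarrow> g z" using analytic_at_imp_isCont[OF analytic(2)] by (simp add: isCont_def)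
      thus "filterlim g (at 0) (at z)"
        using eventually_nonzero \<open>g z = 0\<close> by (simp add: filterlim_at)
    qed (use coprime \<open>g z = 0\<close> in auto)
  next
    assume pole: "is_pole (\<lambda>z. p z / g z) z"
    show "g z = 0"
    proof (rule ccontr)
      assume "g z \<noteq> 0"
      hence "(\<lambda>z. p z / g z) analytic_on {z}"
        by (intro analytic_intros analytic) auto
      thus False using pole analytic_at_imp_no_pole by blast
    qed
  qed
  have "zorder (\<lambda>z. p z / g z) z = - zorder g z" if z: "g z = 0" for z
  proof -
    have "eventually (\<lambda>w. p w \<noteq> 0) (at z)"
      using analytic_at_imp_isCont[OF analytic(1)] coprime[OF z]
      unfolding isCont_def by (rule tendsto_imp_eventually_ne)
    hence "zorder (\<lambda>z. p z / g z) z = zorder p z - zorder g z"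
      using eventually_nonzero analytic[THEN analytic_on_imp_meromorphic_on]
      by (intro zorder_divide) (auto intro: eventually_frequently)
    thus ?thesis using zorder_eq_0I[OF analytic(1) coprime[OF z]] by simp
  qed
  thus ?thesis unfolding pole_count_def pole by (intro sum.cong) auto
qed

end

text \<open>
  The summand for \<open>a = 0\<close> is \<open>m 0 * ln r\<close>, as \<open>ln 0 = 0\<close>.
\<close>
lemma int_pole_count_sum:
  fixes Z :: "complex set"
  assumes fin: "finite Z" and r: "0 < r"
    and count: "\<And>s. s \<in> {0..r} \<Longrightarrow> pole_count s f = (\<Sum>a | a \<in> Z \<and> norm a \<le> s. m a)"
  shows "int_pole_count r f = (\<Sum>a\<in>Z. real (m a) * (ln (max r (norm a)) - ln (norm a)))"
proof -
  \<comment> \<open>The contribution of a single pole \<open>a\<close> to n(s) / s. Its integral is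
    \<open>ln r - ln (norm a)\<close> if the pole lies in the disc and 0 otherwise; the maximum with
    \<open>norm a\<close> covers both cases.\<close>
  define \<kappa> where "\<kappa> a s = (if norm a \<le> s then 1 / s else 0)" for a :: complex and s :: real
  have \<kappa>_int: "(\<kappa> a has_integral (ln (max r (norm a)) - ln (norm a))) {0..r}" if "a \<noteq> 0" for a
  proof (cases "norm a \<le> r")
    case True
    have pos: "0 < s" if "s \<in> {norm a..r}" for s
      using that \<open>a \<noteq> 0\<close> by (metis atLeastAtMost_iff less_le_trans zero_less_norm_iff)
    have "((\<lambda>s. 1 / s) has_integral (ln r - ln (norm a))) {norm a..r}"
      using True that
      by (intro fundamental_theorem_of_calculus)
        (auto intro!: derivative_eq_intros pos simp flip: has_real_derivative_iff_has_vector_derivative)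
    hence "((\<lambda>s. if s \<in> cbox (norm a) r then 1 / s else 0) has_integral (ln r - ln (norm a))) (cbox 0 r)"
      by (intro has_integral_restrict_closed_subinterval) auto
    hence "(\<kappa> a has_integral (ln r - ln (norm a))) {0..r}"
      unfolding interval_cbox by (rule has_integral_eq[rotated]) (auto simp: \<kappa>_def)
    thus ?thesis using True by (simp add: max_def)
  next
    case False
    hence "(\<kappa> a has_integral 0) {0..r}"
      by (intro has_integral_is_0) (auto simp: \<kappa>_def)
    thus ?thesis using False by (simp add: max_def)
  qed
  have count0: "real (pole_count 0 f) = (if 0 \<in> Z then real (m 0) else 0)"
  proof -
    have "{a. a \<in> Z \<and> norm a \<le> 0} = (if 0 \<in> Z then {0} else {})" by auto
    thus ?thesis using count[of 0] r by simp
  qed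
  \<comment> \<open>Subtracting the count at 0 removes exactly the pole at the origin, whose kernel
    1 / s would not be integrable.\<close>
  have integrand: "(real (pole_count s f) - real (pole_count 0 f)) / s = (\<Sum>a\<in>Z - {0}. real (m a) * \<kappa> a s)"
    if s: "s \<in> {0..r}" for s
  proof -
    have "real (pole_count s f) = (\<Sum>a\<in>Z. if norm a \<le> s then real (m a) else 0)"
      unfolding count[OF s] using fin by (simp add: sum.If_cases Int_def)
    also have "\<dots> = real (pole_count 0 f) + (\<Sum>a\<in>Z - {0}. if norm a \<le> s then real (m a) else 0)"
      using s fin by (auto simp: count0 sum.remove[of Z 0])
    finally have "real (pole_count s f) - real (pole_count 0 f) =
        (\<Sum>a\<in>Z - {0}. if norm a \<le> s then real (m a) else 0)" by simp
    moreover have "(if norm a \<le> s then real (m a) else 0) / s = real (m a) * \<kappa> a s" for a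
      by (simp add: \<kappa>_def)
    ultimately show ?thesis by (simp only: sum_divide_distrib)
  qed
  have kernels: "((\<lambda>s. \<Sum>a\<in>Z - {0}. real (m a) * \<kappa> a s) has_integral
          (\<Sum>a\<in>Z - {0}. real (m a) * (ln (max r (norm a)) - ln (norm a)))) {0..r}"
    using fin \<kappa>_int by (intro has_integral_sum has_integral_mult_right) auto
  have "integral {0..r} (\<lambda>s. (real (pole_count s f) - real (pole_count 0 f)) / s) =
          (\<Sum>a\<in>Z - {0}. real (m a) * (ln (max r (norm a)) - ln (norm a)))"
    by (rule integral_unique, rule has_integral_eq[OF _ kernels], rule integrand[symmetric])
  moreover have "real (pole_count 0 f) * ln r = (\<Sum>a\<in>Z \<inter> {0}. real (m a) * (ln (max r (norm a)) - ln (norm a)))"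
    using r by (auto simp: count0)
  ultimately show ?thesis
    unfolding int_pole_count_def
    using sum.Int_Diff[OF fin, of "\<lambda>a. real (m a) * (ln (max r (norm a)) - ln (norm a))" "{0}"] by linarith
qed

text \<open>The limit is the leading Taylor coefficient of \<open>g\<close> at 0, so a zero at the
  origin is allowed. In the factorization of \<open>g\<close>, the circle mean and the counting
  function share the terms \<open>m a * ln (max r (norm a))\<close>; what remains is the logarithm
  of the modulus of that coefficient.\<close>

theorem (in nonzero_entire) jensen_formula:
  assumes r: "0 < r"
  shows "((\<lambda>\<theta>. ln (norm (g (of_real r * cis \<theta>)))) has_integral
           2 * pi * (ln (norm (Lim (at 0) (\<lambda>z. g z / z ^ nat (zorder g 0)))) + int_pole_count r (\<lambda>z. 1 / g z)))
         {0..2 * pi}"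
proof -
  \<comment> \<open>Some radius beyond r, so that the closed disc lies in the ball. Zeros with
    \<open>norm a > r\<close> cancel, since then \<open>max r (norm a) = norm a\<close>.\<close>
  define R where "R = r + 1"
  define Z where "Z = {a. norm a \<le> R \<and> g a = 0}"
  define m where "m a = nat (zorder g a)" for a
  have fin: "finite Z" unfolding Z_def by (rule finite_zeros)
  obtain h where h: "h holomorphic_on ball 0 R" "\<And>z. z \<in> ball 0 R \<Longrightarrow> h z \<noteq> 0"
      and g_eq: "\<And>z. z \<in> ball 0 R \<Longrightarrow> g z = h z * (\<Prod>a\<in>Z. (z - a) ^ m a)"
    using factor_zeros_disc[of R] unfolding Z_def m_def by blast

  have factor_mean: "((\<lambda>\<theta>. ln (norm (h (of_real r * cis \<theta>))) + (\<Sum>a\<in>Z. real (m a) * ln (norm (of_real r * cis \<theta> - a))))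
          has_integral (2 * pi * ln (norm (h 0)) + (\<Sum>a\<in>Z. real (m a) * (2 * pi * ln (max r (norm a)))))) {0..2 * pi}"
    using h r fin
    by (intro has_integral_add has_integral_sum has_integral_mult_right circle_mean_ln_linear
        circle_mean_ln_nonzero[where R = R]) (auto simp: R_def)
  have zeros: "negligible (\<Union>a\<in>Z. {\<theta>. cis \<theta> = a / of_real r})"
    using fin by (auto intro: negligible_cis_eq)
  have factor_ln: "ln (norm (g (of_real r * cis \<theta>))) =
      ln (norm (h (of_real r * cis \<theta>))) + (\<Sum>a\<in>Z. real (m a) * ln (norm (of_real r * cis \<theta> - a)))"
    if "\<theta> \<in> {0..2 * pi} - (\<Union>a\<in>Z. {\<theta>. cis \<theta> = a / of_real r})" for \<theta>
  proof -
    have z: "of_real r * cis \<theta> \<in> ball 0 R" using r by (simp add: norm_mult R_def)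
    have nz: "of_real r * cis \<theta> - a \<noteq> 0" if "a \<in> Z" for a
      using that \<open>\<theta> \<in> _\<close> r by (auto simp: field_simps)
    have "norm (g (of_real r * cis \<theta>)) =
        norm (h (of_real r * cis \<theta>)) * (\<Prod>a\<in>Z. norm (of_real r * cis \<theta> - a) ^ m a)"
      unfolding g_eq[OF z] by (simp add: norm_mult norm_power flip: prod_norm)
    also have "ln \<dots> = ln (norm (h (of_real r * cis \<theta>))) + ln (\<Prod>a\<in>Z. norm (of_real r * cis \<theta> - a) ^ m a)"
      using h(2)[OF z] nz by (intro ln_mult_pos prod_pos) auto
    also have "ln (\<Prod>a\<in>Z. norm (of_real r * cis \<theta> - a) ^ m a) =
        (\<Sum>a\<in>Z. real (m a) * ln (norm (of_real r * cis \<theta> - a)))"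
      using nz fin by (subst ln_prod) (auto simp: ln_realpow intro!: sum.cong)
    finally show ?thesis .
  qed
  have mean: "((\<lambda>\<theta>. ln (norm (g (of_real r * cis \<theta>)))) has_integral
      (2 * pi * ln (norm (h 0)) + (\<Sum>a\<in>Z. real (m a) * (2 * pi * ln (max r (norm a)))))) {0..2 * pi}"
    by (rule has_integral_spike[OF zeros factor_ln factor_mean])

  have "((\<lambda>z. h z * (\<Prod>a\<in>Z - {0}. (z - a) ^ m a)) \<longlongrightarrow> h 0 * (\<Prod>a\<in>Z - {0}. (0 - a) ^ m a)) (at 0)"
  proof -
    have "isCont h 0"
      using h(1) r unfolding R_def
      by (intro analytic_at_imp_isCont holomorphic_on_imp_analytic_at[of _ "ball 0 (r + 1)"]) auto
    thus ?thesis by (intro tendsto_intros) (simp add: isCont_def)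
  qed
  moreover have "eventually (\<lambda>z. h z * (\<Prod>a\<in>Z - {0}. (z - a) ^ m a) = g z / z ^ m 0) (at 0)"
  proof -
    have "eventually (\<lambda>z. z \<in> ball 0 R - {0}) (at 0)"
      using r by (intro eventually_at_in_open) (auto simp: R_def)
    thus ?thesis
    proof eventually_elim
      case (elim z)
      have "m 0 = 0" if "0 \<notin> Z"
        using that r zorder_nonzero[of 0] by (auto simp: Z_def R_def m_def)
      hence "(\<Prod>a\<in>Z. (z - a) ^ m a) = z ^ m 0 * (\<Prod>a\<in>Z - {0}. (z - a) ^ m a)"
        using fin by (cases "0 \<in> Z") (simp_all add: prod.remove)
      thus ?case using elim g_eq[of z] by simp
    qed
  qed
  ultimately have "Lim (at 0) (\<lambda>z. g z / z ^ m 0) = h 0 * (\<Prod>a\<in>Z - {0}. (0 - a) ^ m a)"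
    by (intro tendsto_Lim) (auto elim: Lim_transform_eventually)
  hence "norm (Lim (at 0) (\<lambda>z. g z / z ^ m 0)) = norm (h 0) * (\<Prod>a\<in>Z - {0}. norm a ^ m a)"
    by (simp add: norm_mult norm_power flip: prod_norm)
  also have "ln \<dots> = ln (norm (h 0)) + ln (\<Prod>a\<in>Z - {0}. norm a ^ m a)"
    using h(2)[of 0] r by (intro ln_mult_pos prod_pos) (auto simp: R_def)
  also have "ln (\<Prod>a\<in>Z - {0}. norm a ^ m a) = (\<Sum>a\<in>Z - {0}. real (m a) * ln (norm a))"
    using fin by (subst ln_prod) (auto simp: ln_realpow intro!: sum.cong)
  \<comment> \<open>A summand for a = 0 may be restored because \<open>ln 0 = 0\<close>.\<close>
  also have "\<dots> = (\<Sum>a\<in>Z. real (m a) * ln (norm a))"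
    using fin by (intro sum.mono_neutral_left) auto
  finally have const: "ln (norm (Lim (at 0) (\<lambda>z. g z / z ^ m 0))) =
      ln (norm (h 0)) + (\<Sum>a\<in>Z. real (m a) * ln (norm a))" .

  have "pole_count s (\<lambda>z. 1 / g z) = (\<Sum>a | a \<in> Z \<and> norm a \<le> s. m a)" if "s \<in> {0..r}" for s
  proof -
    have "{a. a \<in> Z \<and> norm a \<le> s} = {z. norm z \<le> s \<and> g z = 0}"
      using that by (auto simp: Z_def R_def)
    thus ?thesis using pole_count_divide[of "\<lambda>_. 1" s] by (simp add: m_def)
  qed
  from int_pole_count_sum[OF fin r this]
  have "int_pole_count r (\<lambda>z. 1 / g z) = (\<Sum>a\<in>Z. real (m a) * (ln (max r (norm a)) - ln (norm a)))" .
  hence "2 * pi * (ln (norm (Lim (at 0) (\<lambda>z. g z / z ^ m 0))) + int_pole_count r (\<lambda>z. 1 / g z)) =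
      2 * pi * ln (norm (h 0)) + (\<Sum>a\<in>Z. real (m a) * (2 * pi * ln (max r (norm a))))"
    unfolding const by (simp add: algebra_simps sum_subtractf sum_distrib_left)
  thus ?thesis using mean by (simp add: m_def)
qed

section \<open>Growth of coprime polynomials, and the mean of the positive part of the
  cosine\<close>

text \<open>A common exponent \<open>n\<close> for two polynomials of different degree: the one of
  lower degree picks up a negative power of x and tends to 0, which is its coefficient at
  \<open>n\<close>.\<close>

lemma poly_div_power_tendsto_coeff:
  fixes p :: "complex poly"
  assumes "degree p \<le> n"
  shows "((\<lambda>x. poly p x / x ^ n) \<longlongrightarrow> coeff p n) at_infinity"
proof (cases "degree p = n")
  case True
  thus ?thesis using poly_divide_tendsto_aux[of p] by simp
next
  case False
  have "((\<lambda>x. poly p x / x ^ degree p * inverse (x ^ (n - degree p))) \<longlongrightarrow> lead_coeff p * 0) at_infinity"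
    using assms False
    by (intro tendsto_mult poly_divide_tendsto_aux tendsto_inverse_0[THEN filterlim_compose]
        filterlim_power_at_infinity filterlim_ident) auto
  moreover have "poly p x / x ^ degree p * inverse (x ^ (n - degree p)) = poly p x / x ^ n" for x
    using assms by (simp add: divide_inverse mult.assoc flip: power_add power_inverse)
  ultimately show ?thesis using assms False by (simp add: coeff_eq_0)
qed

lemma bounded_of_continuous_tendsto_at_infinity:
  fixes f :: "complex \<Rightarrow> real"
  assumes cont: "continuous_on UNIV f" and lim: "(f \<longlongrightarrow> l) at_infinity"
  shows "\<exists>B. \<forall>x. \<bar>f x\<bar> \<le> B"
proof -
  obtain R where R: "\<And>x. R \<le> norm x \<Longrightarrow> dist (f x) l < 1"
    using tendstoD[OF lim, of 1] by (auto simp: eventually_at_infinity)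
  have "bounded (f ` cball 0 R)"
    using cont by (intro compact_imp_bounded compact_continuous_image) (auto intro: continuous_on_subset)
  then obtain B where B: "\<And>y. y \<in> f ` cball 0 R \<Longrightarrow> norm y \<le> B"
    unfolding bounded_iff by blast
  have "\<bar>f x\<bar> \<le> max B (\<bar>l\<bar> + 1)" for x
  proof (cases "R \<le> norm x")
    case True
    thus ?thesis using R[OF True] by (auto simp: dist_real_def)
  next
    case False
    thus ?thesis using B[of "f x"] by (simp add: le_max_iff_disj)
  qed
  thus ?thesis by blast
qed

lemma coprime_no_common_root:
  fixes P Q :: "'a::field poly"
  assumes "coprime P Q" "poly P u = 0"
  shows "poly Q u \<noteq> 0"
proof
  assume "poly Q u = 0"
  hence "is_unit [:-u, 1:]"
    using assms by (intro coprime_common_divisor[of P Q]) (auto simp: poly_eq_0_iff_dvd)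
  thus False by (simp add: is_unit_poly_iff)
qed

text \<open>The quotient \<open>\<phi>\<close> is continuous, positive because there is no common
  root, and has a positive limit at infinity because one of the polynomials has degree
  \<open>n\<close>. So \<open>ln (\<phi> u)\<close> is continuous with a finite limit, hence
  bounded.\<close>

lemma ln_max_coprime_polys:
  fixes P Q :: "complex poly"
  assumes coprime: "coprime P Q"
  defines "n \<equiv> max (degree P) (degree Q)"
  shows "\<exists>B. \<forall>u. \<bar>ln (max (norm (poly P u)) (norm (poly Q u))) - real n * ln (max 1 (norm u))\<bar> \<le> B"
proof -
  define \<phi> where "\<phi> u = max (norm (poly P u)) (norm (poly Q u)) / max 1 (norm u) ^ n" for u
  define L where "L = max (norm (coeff P n)) (norm (coeff Q n))"
  have pos: "0 < max (norm (poly P u)) (norm (poly Q u))" for u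
    using coprime_no_common_root[OF coprime, of u] by (auto simp: less_max_iff_disj)
  have pos1: "0 < max 1 (norm u) ^ n" for u :: complex by simp
  have "P \<noteq> 0 \<or> Q \<noteq> 0" using coprime by auto
  hence "coeff P n \<noteq> 0 \<or> coeff Q n \<noteq> 0"
  \<comment> \<open>The case split selects a nonzero polynomial of degree \<open>n\<close>;
    \<open>P = 0\<close> goes with \<open>Q\<close> because its degree 0 may tie with that of a
    constant \<open>Q\<close>.\<close>
  proof (cases "P = 0 \<or> degree P < degree Q")
    case True
    hence "n = degree Q" "Q \<noteq> 0" using \<open>P \<noteq> 0 \<or> Q \<noteq> 0\<close> by (auto simp: n_def)
    thus ?thesis by simp
  next
    case False
    hence "n = degree P" "P \<noteq> 0" by (auto simp: n_def)
    thus ?thesis by simp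
  qed
  hence L: "0 < L" by (auto simp: L_def less_max_iff_disj)
  have "((\<lambda>u. max (norm (poly P u / u ^ n)) (norm (poly Q u / u ^ n))) \<longlongrightarrow> L) at_infinity"
    unfolding L_def
    by (intro tendsto_max tendsto_norm poly_div_power_tendsto_coeff) (auto simp: n_def)
  moreover have "eventually (\<lambda>u. max (norm (poly P u / u ^ n)) (norm (poly Q u / u ^ n)) = \<phi> u) at_infinity"
    unfolding eventually_at_infinity
  proof (intro exI allI impI)
    fix u :: complex assume "1 \<le> norm u"
    thus "max (norm (poly P u / u ^ n)) (norm (poly Q u / u ^ n)) = \<phi> u"
      by (simp add: \<phi>_def norm_divide norm_power max_divide_distrib_right)
  qed
  ultimately have "(\<phi> \<longlongrightarrow> L) at_infinity" by (rule Lim_transform_eventually)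
  hence lim: "((\<lambda>u. ln (\<phi> u)) \<longlongrightarrow> ln L) at_infinity" using L by (intro tendsto_ln) auto
  have \<phi>_pos: "0 < \<phi> u" for u unfolding \<phi>_def using pos[of u] pos1[of u] by (rule divide_pos_pos)
  have "continuous_on UNIV \<phi>"
    unfolding \<phi>_def using pos1 by (intro continuous_intros) (metis less_irrefl)
  hence "continuous_on UNIV (\<lambda>u. ln (\<phi> u))"
    using \<phi>_pos by (intro continuous_on_ln) (auto simp: less_imp_neq[symmetric])
  from bounded_of_continuous_tendsto_at_infinity[OF this lim]
  obtain B where "\<And>u. \<bar>ln (\<phi> u)\<bar> \<le> B" by blast
  moreover have "ln (\<phi> u) = ln (max (norm (poly P u)) (norm (poly Q u))) - real n * ln (max 1 (norm u))" for u
    unfolding \<phi>_def using pos[of u] pos1[of u] by (subst ln_div) (auto simp: ln_realpow)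
  ultimately show ?thesis by auto
qed

text \<open>The cosine is nonnegative on the first and last quarter of the period, each contributing
  1. This 2, divided by the length \<open>2 * pi\<close>, gives the factor 1 / pi of the
  theorem.\<close>

lemma has_integral_cos_pos_part: "((\<lambda>\<theta>. max 0 (cos \<theta>)) has_integral 2) {0..2 * pi}"
proof -
  have cos_int: "(cos has_integral (sin b - sin a)) {a..b}" if "a \<le> b" for a b :: real
    using that by (intro fundamental_theorem_of_calculus)
      (auto intro!: derivative_eq_intros simp flip: has_real_derivative_iff_has_vector_derivative)
  have "((\<lambda>\<theta>. max 0 (cos \<theta>)) has_integral (sin (pi / 2) - sin 0)) {0..pi / 2}"
    by (rule has_integral_eq[OF _ cos_int]) (auto simp: max_def cos_ge_zero)
  moreover have "((\<lambda>\<theta>. max 0 (cos \<theta>)) has_integral 0) {pi / 2..3 * pi / 2}"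
  proof (rule has_integral_is_0)
    fix \<theta> assume "\<theta> \<in> {pi / 2..3 * pi / 2}"
    hence "0 \<le> cos (\<theta> - pi)" by (intro cos_ge_zero) auto
    thus "max 0 (cos \<theta>) = 0" by simp
  qed
  ultimately have first: "((\<lambda>\<theta>. max 0 (cos \<theta>)) has_integral (sin (pi / 2) - sin 0 + 0)) {0..3 * pi / 2}"
    by (intro has_integral_combine[where c = "pi / 2"]) auto
  have last: "((\<lambda>\<theta>. max 0 (cos \<theta>)) has_integral (sin (2 * pi) - sin (3 * pi / 2))) {3 * pi / 2..2 * pi}"
  proof (rule has_integral_eq[OF _ cos_int])
    fix \<theta> assume "\<theta> \<in> {3 * pi / 2..2 * pi}"
    hence "0 \<le> cos (\<theta> - 2 * pi)" by (intro cos_ge_zero) auto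
    thus "cos \<theta> = max 0 (cos \<theta>)" by (simp add: cos_diff)
  qed auto
  have "((\<lambda>\<theta>. max 0 (cos \<theta>)) has_integral
      (sin (pi / 2) - sin 0 + 0 + (sin (2 * pi) - sin (3 * pi / 2)))) {0..2 * pi}"
    by (rule has_integral_combine[OF _ _ first last]) auto
  moreover have "sin (3 * pi / 2) = - 1"
    using sin_3over2_pi by simp
  ultimately show ?thesis by simp
qed

section \<open>The characteristic of a quotient of entire functions without common zeros\<close>

context nonzero_entire
begin

lemma negligible_zeros_circle:
  assumes "0 < r"
  shows "negligible {\<theta>. g (of_real r * cis \<theta>) = 0}"
proof -
  have "negligible (\<Union>a\<in>{a. norm a \<le> r \<and> g a = 0}. {\<theta>. cis \<theta> = a / of_real r})"
    using finite_zeros by (auto intro: negligible_cis_eq)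
  moreover have "{\<theta>. g (of_real r * cis \<theta>) = 0} \<subseteq> (\<Union>a\<in>{a. norm a \<le> r \<and> g a = 0}. {\<theta>. cis \<theta> = a / of_real r})"
  proof
    fix \<theta> assume "\<theta> \<in> {\<theta>. g (of_real r * cis \<theta>) = 0}"
    thus "\<theta> \<in> (\<Union>a\<in>{a. norm a \<le> r \<and> g a = 0}. {\<theta>. cis \<theta> = a / of_real r})"
      using assms by (intro UN_I[of "of_real r * cis \<theta>"]) (auto simp: norm_mult)
  qed
  ultimately show ?thesis by (rule negligible_subset)
qed

text \<open>Without common zeros the maximum never vanishes, so the integrand is continuous even
  where the circle meets zeros of \<open>p\<close> or \<open>g\<close>.\<close>

lemma ln_max_circle_integrable:
  assumes p: "p holomorphic_on UNIV" and coprime: "\<And>z. g z = 0 \<Longrightarrow> p z \<noteq> 0"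
  shows "(\<lambda>\<theta>. ln (max (norm (p (of_real r * cis \<theta>))) (norm (g (of_real r * cis \<theta>))))) integrable_on {0..2 * pi}"
proof (intro integrable_continuous_real continuous_on_ln continuous_on_max continuous_on_norm)
  show "continuous_on {0..2 * pi} (\<lambda>\<theta>. p (of_real r * cis \<theta>))"
    by (rule continuous_on_compose2[OF holomorphic_on_imp_continuous_on[OF p]]) (auto intro!: continuous_intros)
  show "continuous_on {0..2 * pi} (\<lambda>\<theta>. g (of_real r * cis \<theta>))"
    by (rule continuous_on_compose2[OF holomorphic_on_imp_continuous_on[OF holo]]) (auto intro!: continuous_intros)
  have "max (norm (p z)) (norm (g z)) \<noteq> 0" for z
    using coprime[of z] by (auto simp: max_def)
  thus "\<forall>\<theta>\<in>{0..2 * pi}. max (norm (p (of_real r * cis \<theta>))) (norm (g (of_real r * cis \<theta>))) \<noteq> 0"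
    by blast
qed

text \<open>Off the zeros of \<open>g\<close> the proximity integrand is the logarithm of the
  maximum minus \<open>ln (norm (g z))\<close>. By Jensen's formula the mean of the latter is the
  counting term plus a constant, so the counting term cancels.\<close>

lemma nevanlinna_char_divide:
  assumes p: "p holomorphic_on UNIV" and coprime: "\<And>z. g z = 0 \<Longrightarrow> p z \<noteq> 0" and r: "0 < r"
  shows "nevanlinna_char r (\<lambda>z. p z / g z) =
     1 / (2 * pi) * integral {0..2 * pi} (\<lambda>\<theta>. ln (max (norm (p (of_real r * cis \<theta>))) (norm (g (of_real r * cis \<theta>)))))
       - ln (norm (Lim (at 0) (\<lambda>z. g z / z ^ nat (zorder g 0))))"
proof -
  let ?u = "\<lambda>\<theta>. of_real r * cis \<theta>"
  define M where "M \<theta> = ln (max (norm (p (?u \<theta>))) (norm (g (?u \<theta>))))" for \<theta>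
  define c where "c = ln (norm (Lim (at 0) (\<lambda>z. g z / z ^ nat (zorder g 0))))"
  have "pole_count s (\<lambda>z. p z / g z) = pole_count s (\<lambda>z. 1 / g z)" for s
    using pole_count_divide[OF p coprime] pole_count_divide[of "\<lambda>_. 1"] by simp
  hence N: "int_pole_count r (\<lambda>z. p z / g z) = int_pole_count r (\<lambda>z. 1 / g z)"
    by (simp add: int_pole_count_def)
  have "(M has_integral integral {0..2 * pi} M) {0..2 * pi}"
    unfolding M_def by (intro integrable_integral ln_max_circle_integrable assms)
  from has_integral_diff[OF this jensen_formula[OF r]]
  have diff: "((\<lambda>\<theta>. M \<theta> - ln (norm (g (?u \<theta>)))) has_integral
      (integral {0..2 * pi} M - 2 * pi * (c + int_pole_count r (\<lambda>z. 1 / g z)))) {0..2 * pi}"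
    by (simp add: c_def)
  have "((\<lambda>\<theta>. log_plus (norm (p (?u \<theta>) / g (?u \<theta>)))) has_integral
      (integral {0..2 * pi} M - 2 * pi * (c + int_pole_count r (\<lambda>z. 1 / g z)))) {0..2 * pi}"
  proof (rule has_integral_spike[OF negligible_zeros_circle[OF r] _ diff])
    fix \<theta> assume "\<theta> \<in> {0..2 * pi} - {\<theta>. g (?u \<theta>) = 0}"
    hence g: "0 < norm (g (?u \<theta>))" by simp
    show "log_plus (norm (p (?u \<theta>) / g (?u \<theta>))) = M \<theta> - ln (norm (g (?u \<theta>)))"
    \<comment> \<open>Where \<open>p\<close> vanishes, \<open>ln 0 = 0\<close> makes the left side
      0, and the maximum equals the modulus of \<open>g\<close>; \<open>ln_div\<close> is left for
      the other case.\<close>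
    proof (cases "p (?u \<theta>) = 0")
      case True
      thus ?thesis by (simp add: log_plus_def M_def max_def)
    next
      case False
      thus ?thesis using g
        by (auto simp: log_plus_def M_def norm_divide ln_div max_def)
    qed
  qed
  from integral_unique[OF this] show ?thesis
    unfolding nevanlinna_char_def proximity_def N M_def c_def by (simp add: field_simps)
qed

end

section \<open>The characteristic of a rational function of exp (z / q)\<close>

theorem proposition7p1:
  fixes q n :: nat and S :: ratfun
  assumes "q > 0"
    and "S \<notin> range ratfun_const"
    and "ratfun_degree S = n"
  shows "(\<lambda>r::real. nevanlinna_char r (\<lambda>z. ratfun_eval S (exp (z / of_nat q)))
            - real n / (pi * real q) * r) \<in> O[at_top](\<lambda>_. 1)"
proof -
  define P where "P = ratfun_num S"
  define Q where "Q = ratfun_denom S"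
  define p where "p z = poly P (exp (z / of_nat q))" for z
  define g where "g z = poly Q (exp (z / of_nat q))" for z
  have n: "n = max (degree P) (degree Q)"
    using assms(3) by (simp add: ratfun_degree_def P_def Q_def)
  have coprime: "coprime P Q"
    unfolding P_def Q_def ratfun_num_def ratfun_denom_def by (rule coprime_quot_of_fract)
  have "Q \<noteq> 0" by (simp add: Q_def ratfun_denom_def)
  have p_holo: "p holomorphic_on UNIV" and g_holo: "g holomorphic_on UNIV"
    unfolding p_def g_def using assms(1) by (auto intro!: holomorphic_intros)
  interpret nonzero_entire g
  proof
    \<comment> \<open>The exponential omits 0, so the point where \<open>Q\<close> is nonzero must
      itself be nonzero; then \<open>of_nat q * Ln u\<close> is mapped to it.\<close>
    have "finite (insert 0 {u. poly Q u = 0})" using poly_roots_finite[OF \<open>Q \<noteq> 0\<close>] by simp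
    then obtain u where "u \<notin> insert 0 {u. poly Q u = 0}"
      using ex_new_if_finite infinite_UNIV_char_0 by blast
    hence "g (of_nat q * Ln u) \<noteq> 0" using assms(1) by (simp add: g_def)
    thus "\<exists>w. g w \<noteq> 0" by blast
  qed (rule g_holo)
  have no_common: "g z = 0 \<Longrightarrow> p z \<noteq> 0" for z
    using coprime_no_common_root[OF coprime] unfolding p_def g_def by blast

  define c where "c = ln (norm (Lim (at 0) (\<lambda>z. g z / z ^ nat (zorder g 0))))"
  obtain B where B: "\<And>u. \<bar>ln (max (norm (poly P u)) (norm (poly Q u))) - real n * ln (max 1 (norm u))\<bar> \<le> B"
    using ln_max_coprime_polys[OF coprime] unfolding n by blast

  have "\<bar>nevanlinna_char r (\<lambda>z. p z / g z) - real n / (pi * real q) * r\<bar> \<le> B + \<bar>c\<bar>" if r: "0 < r" for r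
  proof -
    define M where "M \<theta> = ln (max (norm (p (of_real r * cis \<theta>))) (norm (g (of_real r * cis \<theta>))))" for \<theta>
    \<comment> \<open>This is \<open>real n * ln (max 1 (norm u))\<close> at u = exp (z / q),
      because the modulus of u is exp (Re z / q).\<close>
    define K where "K \<theta> = real n * r / real q * max 0 (cos \<theta>)" for \<theta>
    have K: "(K has_integral real n * r / real q * 2) {0..2 * pi}"
      unfolding K_def by (intro has_integral_mult_right has_integral_cos_pos_part)
    have M: "(M has_integral integral {0..2 * pi} M) {0..2 * pi}"
      unfolding M_def by (intro integrable_integral ln_max_circle_integrable p_holo no_common)
    have MK: "\<bar>M \<theta> - K \<theta>\<bar> \<le> B" for \<theta>
    proof -
      let ?u = "exp (of_real r * cis \<theta> / of_nat q)"
      have "norm ?u = exp (r * cos \<theta> / real q)" by (simp add: norm_exp_eq_Re)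
      hence "ln (max 1 (norm ?u)) = max 0 (r * cos \<theta> / real q)"
        by (auto simp: max_def)
      also have "\<dots> = r / real q * max 0 (cos \<theta>)"
        using r assms(1) by (auto simp: max_def zero_le_mult_iff mult_le_0_iff divide_le_0_iff zero_le_divide_iff)
      finally have "real n * ln (max 1 (norm ?u)) = K \<theta>" by (simp add: K_def)
      thus ?thesis using B[of ?u] by (simp add: M_def p_def g_def)
    qed
    \<comment> \<open>The pointwise bound \<open>B\<close> does not depend on r, and averaging over
      the circle preserves it.\<close>
    have "norm (integral {0..2 * pi} M - real n * r / real q * 2) \<le> B * measure lborel {0..2 * pi}"
    proof (rule has_integral_bound_real)
      show "0 \<le> B" using MK[of 0] by linarith
      show "((\<lambda>\<theta>. M \<theta> - K \<theta>) has_integral (integral {0..2 * pi} M - real n * r / real q * 2)) {0..2 * pi}"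
        using M K by (rule has_integral_diff)
    qed (use MK in auto)
    hence "\<bar>integral {0..2 * pi} M - real n * r / real q * 2\<bar> / (2 * pi) \<le> B"
      by (simp add: divide_le_eq)
    also have "\<bar>integral {0..2 * pi} M - real n * r / real q * 2\<bar> / (2 * pi) =
        \<bar>(integral {0..2 * pi} M - real n * r / real q * 2) / (2 * pi)\<bar>"
      by simp
    also have "(integral {0..2 * pi} M - real n * r / real q * 2) / (2 * pi) =
        1 / (2 * pi) * integral {0..2 * pi} M - real n / (pi * real q) * r"
      by (simp add: diff_divide_distrib)
    finally have "\<bar>1 / (2 * pi) * integral {0..2 * pi} M - real n / (pi * real q) * r\<bar> \<le> B" .
    moreover have "nevanlinna_char r (\<lambda>z. p z / g z) = 1 / (2 * pi) * integral {0..2 * pi} M - c"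
      unfolding c_def M_def by (rule nevanlinna_char_divide[OF p_holo _ r]) (rule no_common)
    ultimately show ?thesis by linarith
  qed
  hence "eventually (\<lambda>r. norm (nevanlinna_char r (\<lambda>z. p z / g z) - real n / (pi * real q) * r)
      \<le> (B + \<bar>c\<bar>) * norm (1 :: real)) at_top"
    by (intro eventually_mono[OF eventually_gt_at_top[of "0 :: real"]]) simp
  hence "(\<lambda>r. nevanlinna_char r (\<lambda>z. p z / g z) - real n / (pi * real q) * r) \<in> O[at_top](\<lambda>_. 1)"
    by (rule bigoI)
  thus ?thesis unfolding ratfun_eval_def p_def g_def P_def Q_def .
qed

end
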